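(* Let $M\in\mathbb{S}^{n\times n}$ be invertible with $t^*(M)=+\infty$, and suppose $(A,B)$ is controllable. Given any $P_0\in\mathbb{S}^{n\times n}$ with $P_0-M$ positive definite, the corresponding unique solution $P_t$ of the differential Riccati equation $$\dot P_t=A'P_t+P_tA+P_tBB'P_t+C'C,$$ with initial value $P_0$ at $t=0$, exists and is given explicitly by $$P_t=\Lambda_t^{11}-\Lambda_t^{12}\,(P_0+\Lambda_t^{22})^{-1}(\Lambda_t^{12})'$$ for all $t\in(0,t^*(P_0))$, and the maximal horizon of existence $t^*(P_0)\in\mathbb{R}_{>0}\cup\{+\infty\}$ is $$t^*(P_0)=\sup\left\{t\in\mathbb{R}_{>0}\ :\ P_0+\Lambda_t^{22}\text{ is negative definite}\right\}.$$
   Context: $\mathbb{S}^{k\times k}$ denotes the real symmetric $k\times k$ matrices; prime denotes transpose; for $U\in\mathbb{R}^{2n\times 2n}$, $U^{ij}$ ($i,j\in\{1,2\}$) are its $n\times n$ blocks. Fix $A\in\mathbb{R}^{n\times n}$, $B\in\mathbb{R}^{n\times m}$, $C\in\mathbb{R}^{p\times n}$. For $P_0\in\mathbb{S}^{n\times n}$ the maximal horizon of existence is $$t^*(P_0)\doteq\sup\{t>0:\ \Sigma_s^{11}+\Sigma_s^{12}P_0\text{ is invertible for all }s\in(0,t]\},$$ where $\Sigma_t\doteq\exp(\mathcal{H}t)$, $\mathcal{H}\doteq\begin{bmatrix}-A&-BB'\\ C'C&A'\end{bmatrix}$. When $t^*(M)=+\infty$, let $Q_t\in\mathbb{S}^{2n\times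 2n}$, $t\ge 0$, be the unique solution of $$\dot Q_t=\hat A'Q_t+Q_t\hat A+Q_t\hat B\hat B'Q_t+\hat C'\hat C,\qquad Q_0=\begin{bmatrix}M&-M\\-M&M\end{bmatrix},$$ with $\hat A=\begin{bmatrix}A&0\\0&0\end{bmatrix}$, $\hat B=\begin{bmatrix}B\\0\end{bmatrix}$, $\hat C=\begin{bmatrix}C&0\end{bmatrix}$ (this solution exists for all $t\ge0$). When in addition $M$ is invertible and $(A,B)$ is controllable, $Q_t^{22}-M$ is positive definite for all $t>0$, and $\Lambda_t\in\mathbb{S}^{2n\times 2n}$, $t>0$, is defined by $$\Lambda_t\doteq\begin{bmatrix}Q_t^{11}+Q_t^{12}(M-Q_t^{22})^{-1}(Q_t^{12})'&Q_t^{12}(M-Q_t^{22})^{-1}M\\ M(M-Q_t^{22})^{-1}(Q_t^{12})'&M(M-Q_t^{22})^{-1}M-M\end{bmatrix}.$$ *)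

theory Defs
  imports "HOL-Analysis.Analysis"
begin

text \<open>Positive definiteness is understood for symmetric matrices, so symmetry is part of it.\<close>

definition pos_def :: "real^'k^'k \<Rightarrow> bool" where
  "pos_def X \<longleftrightarrow> transpose X = X \<and> (\<forall>v. v \<noteq> 0 \<longrightarrow> v \<bullet> (X *v v) > 0)"

definition neg_def :: "real^'k^'k \<Rightarrow> bool" where
  "neg_def X \<longleftrightarrow> pos_def (- X)"

text \<open>The multiplication \<open>*\<close> on \<open>real^'k^'k\<close> is componentwise, so \<open>exp\<close> and \<open>^\<close> cannot be used for
  matrices; the exponential series is formed with the matrix product \<open>**\<close>.\<close>

definition mat_exp :: "real^'k^'k \<Rightarrow> real^'k^'k" where
  "mat_exp X = (\<Sum>i. (1 / fact i) *\<^sub>R (((**) X ^^ i) (mat 1)))"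

text \<open>Block matrices are indexed by sum types: \<open>Inl\<close> is the first block index, \<open>Inr\<close> the second.\<close>

definition vblock :: "real^'k^'a \<Rightarrow> real^'k^'b \<Rightarrow> real^'k^('a + 'b)" where
  "vblock X Y = (\<chi> i. case i of Inl a \<Rightarrow> X $ a | Inr b \<Rightarrow> Y $ b)"

definition hblock :: "real^'a^'k \<Rightarrow> real^'b^'k \<Rightarrow> real^('a + 'b)^'k" where
  "hblock X Y = (\<chi> i j. case j of Inl a \<Rightarrow> X $ i $ a | Inr b \<Rightarrow> Y $ i $ b)"

definition block4 ::
  "real^'a^'c \<Rightarrow> real^'b^'c \<Rightarrow> real^'a^'d \<Rightarrow> real^'b^'d \<Rightarrow> real^('a + 'b)^('c + 'd)" where
  "block4 X11 X12 X21 X22 = vblock (hblock X11 X12) (hblock X21 X22)"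

definition blk11 :: "real^('a::finite + 'b::finite)^('c::finite + 'd::finite) \<Rightarrow> real^'a^'c" where
  "blk11 U = (\<chi> i j. U $ Inl i $ Inl j)"

definition blk12 :: "real^('a::finite + 'b::finite)^('c::finite + 'd::finite) \<Rightarrow> real^'b^'c" where
  "blk12 U = (\<chi> i j. U $ Inl i $ Inr j)"

definition blk22 :: "real^('a::finite + 'b::finite)^('c::finite + 'd::finite) \<Rightarrow> real^'b^'d" where
  "blk22 U = (\<chi> i j. U $ Inr i $ Inr j)"

text \<open>Controllability of \<open>x' = A x + B u\<close>: every state can be steered to every other state
  in some positive time by a continuous control.\<close>

definition controllable :: "real^'n^'n \<Rightarrow> real^'m^'n \<Rightarrow> bool" where
  "controllable A B \<longleftrightarrow>
     (\<forall>x0 x1. \<exists>T>0. \<exists>(u :: real \<Rightarrow> real^'m) (x :: real \<Rightarrow> real^'n).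
        continuous_on {0..T} u \<and>
        (\<forall>t\<in>{0..T}. (x has_vector_derivative (A *v x t + B *v u t)) (at t within {0..T})) \<and>
        x 0 = x0 \<and> x T = x1)"

definition hamiltonian :: "real^'n^'n \<Rightarrow> real^'m^'n \<Rightarrow> real^'n^'p \<Rightarrow> real^('n + 'n)^('n + 'n)" where
  "hamiltonian A B C = block4 (- A) (- (B ** transpose B)) (transpose C ** C) (transpose A)"

definition symplectic_flow ::
  "real^'n^'n \<Rightarrow> real^'m^'n \<Rightarrow> real^'n^'p \<Rightarrow> real \<Rightarrow> real^('n + 'n)^('n + 'n)" where
  "symplectic_flow A B C t = mat_exp (t *\<^sub>R hamiltonian A B C)"

definition max_horizon ::
  "real^'n^'n \<Rightarrow> real^'m^'n \<Rightarrow> real^'n^'p \<Rightarrow> real^'n^'n \<Rightarrow> ereal" where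
  "max_horizon A B C P0 =
     Sup (ereal ` {t. 0 < t \<and>
       (\<forall>s\<in>{0<..t}. invertible
          (blk11 (symplectic_flow A B C s) + blk12 (symplectic_flow A B C s) ** P0))})"

definition solves_DRE ::
  "real^'k^'k \<Rightarrow> real^'m^'k \<Rightarrow> real^'k^'p \<Rightarrow> real^'k^'k \<Rightarrow> real set \<Rightarrow> (real \<Rightarrow> real^'k^'k) \<Rightarrow> bool"
where
  "solves_DRE A B C P0 I P \<longleftrightarrow> P 0 = P0 \<and>
     (\<forall>t\<in>I. (P has_vector_derivative
        (transpose A ** P t + P t ** A + P t ** B ** transpose B ** P t + transpose C ** C))
        (at t within I))"

text \<open>The symmetric solution is determined only on \<open>t \<ge> 0\<close>; the choice operator leaves the
  values for \<open>t < 0\<close>, and everything if there is no global solution, unspecified.\<close>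

definition Q_sol ::
  "real^'n^'n \<Rightarrow> real^'m^'n \<Rightarrow> real^'n^'p \<Rightarrow> real^'n^'n \<Rightarrow> real \<Rightarrow> real^('n + 'n)^('n + 'n)" where
  "Q_sol A B C M =
     (SOME Q. solves_DRE (block4 A 0 0 (0 :: real^'n^'n)) (vblock B (0 :: real^'m^'n))
                (hblock C (0 :: real^'n^'p)) (block4 M (- M) (- M) M) {0..} Q \<and>
              (\<forall>t\<ge>0. transpose (Q t) = Q t))"

definition Lambda ::
  "real^'n^'n \<Rightarrow> real^'m^'n \<Rightarrow> real^'n^'p \<Rightarrow> real^'n^'n \<Rightarrow> real \<Rightarrow> real^('n + 'n)^('n + 'n)" where
  "Lambda A B C M t =
     (let Q11 = blk11 (Q_sol A B C M t);
          Q12 = blk12 (Q_sol A B C M t);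
          Q22 = blk22 (Q_sol A B C M t);
          W = matrix_inv (M - Q22)
      in block4 (Q11 + Q12 ** W ** transpose Q12) (Q12 ** W ** M)
                (M ** W ** transpose Q12) (M ** W ** M - M))"

end

theory Submission
  imports Defs
begin

text \<open>
Write \<open>\<Sigma>\<^sub>t [I; P] = [flowX P t; flowY P t]\<close>. Wherever \<open>flowX P\<close> is invertible, \<open>flowY P (flowX P)\<^sup>-\<^sup>1\<close> solves the
Riccati equation with initial value \<open>P\<close> (\<open>riccati_curve_solves_DRE\<close>), for symmetric \<open>P\<close> it is symmetric because
the flow is symplectic (\<open>wronskian_constant\<close>), and it is the only solution (\<open>solves_DRE_unique\<close>).

For \<open>P = M\<close> the matrix \<open>X = flowX M\<close> is invertible at all times. Put \<open>Z = X\<^sup>-\<^sup>1\<close> and \<open>G = - Z \<Sigma>\<^sup>1\<^sup>2\<close>. The invariance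
of the symplectic form yields \<open>G' = Z B B\<^sup>T Z\<^sup>T\<close>, so \<open>G\<close> is a gramian: symmetric, zero at \<open>0\<close>,
nondecreasing, and positive definite for \<open>t > 0\<close> by controllability (\<open>G_pos_def\<close>). All other data are
expressed by \<open>Z\<close>, \<open>G\<close> and the reference solution \<open>S\<close>: the augmented equation is solved by
\<open>Q = [S, - Z\<^sup>T M; - M Z, M + M G M]\<close>, hence \<open>\<Lambda>\<^sup>1\<^sup>1 = S - Z\<^sup>T G\<^sup>-\<^sup>1 Z\<close>, \<open>\<Lambda>\<^sup>1\<^sup>2 = Z\<^sup>T G\<^sup>-\<^sup>1\<close> and \<open>\<Lambda>\<^sup>2\<^sup>2 = - G\<^sup>-\<^sup>1 - M\<close>
(\<open>Lambda_blocks\<close>).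

With \<open>D = P\<^sub>0 - M\<close> one has \<open>flowX P\<^sub>0 = X (I - G D) = X (D\<^sup>-\<^sup>1 - G) D\<close> (\<open>flow_factor\<close>). The matrix \<open>D\<^sup>-\<^sup>1 - G\<close>
decreases from the positive definite \<open>D\<^sup>-\<^sup>1\<close>, so it is invertible on the whole of \<open>(0, t]\<close> iff it is
positive definite at \<open>t\<close> (\<open>pos_def_path\<close>), iff \<open>G\<^sup>-\<^sup>1 - D\<close> is positive definite
(\<open>pos_def_matrix_inv_diff\<close>), iff \<open>P\<^sub>0 + \<Lambda>\<^sup>2\<^sup>2 = D - G\<^sup>-\<^sup>1\<close> is negative definite. The two suprema are thus
taken over the same set (\<open>neg_def_iff_flow_invertible\<close>), and the formula for \<open>P\<^sub>t\<close> is the algebraic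
identity \<open>riccati_curve_eq_Lambda\<close>.
\<close>

section \<open>Matrix algebra\<close>

lemma bounded_bilinear_matrix_mult:
  "bounded_bilinear ((**) :: real^'a^'b \<Rightarrow> real^'c^'a \<Rightarrow> real^'c^'b)"
proof (subst bilinear_conv_bounded_bilinear[symmetric])
  show "bilinear ((**) :: real^'a^'b \<Rightarrow> real^'c^'a \<Rightarrow> real^'c^'b)"
    unfolding bilinear_def linear_iff matrix_matrix_mult_def
    by (simp add: vec_eq_iff sum.distrib algebra_simps sum_distrib_left)
qed

interpretation matmul: bounded_bilinear "(**) :: real^'a^'b \<Rightarrow> real^'c^'a \<Rightarrow> real^'c^'b"
  by (rule bounded_bilinear_matrix_mult)

lemma bounded_linear_transpose: "bounded_linear (transpose :: real^'a^'b \<Rightarrow> real^'b^'a)"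
  by (subst linear_conv_bounded_linear[symmetric], rule linearI)
     (simp_all add: transpose_def vec_eq_iff)

lemma transpose_arith:
  fixes X Y :: "real^'a^'b"
  shows "transpose (X + Y) = transpose X + transpose Y"
    and "transpose (X - Y) = transpose X - transpose Y"
    and "transpose (- X) = - transpose X"
    and "transpose (0 :: real^'a^'b) = 0"
  by (simp_all add: transpose_def vec_eq_iff)

lemmas mat_simps =
  matmul.add_left matmul.add_right matmul.diff_left matmul.diff_right
  matmul.minus_left matmul.minus_right matmul.zero_left matmul.zero_right
  matrix_mul_assoc matrix_mul_lid matrix_mul_rid matrix_transpose_mul
  transpose_arith

lemma matrix_inv_mult:
  fixes X :: "real^'a^'a"
  assumes "invertible X"
  shows "X ** matrix_inv X = mat 1" "matrix_inv X ** X = mat 1"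
proof -
  have "X ** matrix_inv X = mat 1 \<and> matrix_inv X ** X = mat 1"
    using assms unfolding invertible_def matrix_inv_def by (rule someI_ex)
  thus "X ** matrix_inv X = mat 1" "matrix_inv X ** X = mat 1" by simp_all
qed

lemma matrix_inv_cancel:
  fixes X :: "real^'a^'a"
  assumes "invertible X"
  shows "W ** X ** matrix_inv X = W" "W ** matrix_inv X ** X = W"
  by (simp_all add: matrix_inv_mult[OF assms] flip: matrix_mul_assoc)

lemma matrix_inv_eqI:
  fixes X :: "real^'a^'a"
  assumes "X ** Y = mat 1"
  shows "invertible X" "matrix_inv X = Y"
proof -
  show inv: "invertible X"
    using assms invertible_right_inverse by blast
  have "matrix_inv X = matrix_inv X ** (X ** Y)" using assms by simp
  also have "\<dots> = Y" by (simp add: matrix_inv_mult[OF inv] matrix_mul_assoc)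
  finally show "matrix_inv X = Y" .
qed

lemma invertible_matrix_inv:
  fixes X :: "real^'a^'a"
  assumes "invertible X"
  shows "invertible (matrix_inv X)" "matrix_inv (matrix_inv X) = X"
  using matrix_inv_eqI[OF matrix_inv_mult(2)[OF assms]] by auto

lemma transpose_matrix_inv:
  fixes X :: "real^'a^'a"
  assumes "invertible X"
  shows "transpose (matrix_inv X) = matrix_inv (transpose X)"
  by (rule matrix_inv_eqI(2)[symmetric])
     (simp add: matrix_inv_mult[OF assms] flip: matrix_transpose_mul)

lemma invertible_minus: "invertible (X :: real^'a^'a) \<Longrightarrow> invertible (- X)"
  by (rule matrix_inv_eqI(1)[of _ "- matrix_inv X"]) (simp add: mat_simps matrix_inv_mult)

section \<open>Derivatives of matrix functions\<close>

lemma has_vector_derivative_matrix: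
  fixes f :: "real \<Rightarrow> real^'a^'b"
  assumes "\<And>i j. ((\<lambda>t. f t $ i $ j) has_real_derivative f' $ i $ j) (at t within I)"
  shows "(f has_vector_derivative f') (at t within I)"
  unfolding has_vector_derivative_def
proof (subst has_derivative_componentwise_within, rule ballI)
  fix b :: "real^'a^'b"
  assume "b \<in> Basis"
  then obtain i j where b: "b = axis i (axis j 1)"
    by (auto simp: Basis_vec_def)
  show "((\<lambda>t. f t \<bullet> b) has_derivative (\<lambda>h. (h *\<^sub>R f') \<bullet> b)) (at t within I)"
    using assms[of i j] by (simp add: b inner_axis has_field_derivative_def mult.commute[of _ "f' $ i $ j"])
qed

lemmas has_vector_derivative_matmul = matmul.has_vector_derivative
lemmas has_vector_derivative_transpose = bounded_linear.has_vector_derivative[OF bounded_linear_transpose]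

lemma differentiable_det:
  fixes f :: "real \<Rightarrow> real^'a^'a"
  assumes "\<And>i j. (\<lambda>t. f t $ i $ j) differentiable (at t within I)"
  shows "(\<lambda>t. det (f t)) differentiable (at t within I)"
  unfolding det_def
proof (intro differentiable_sum differentiable_mult differentiable_const ballI)
  fix p
  have "\<exists>g'. \<forall>i. ((\<lambda>t. f t $ i $ p i) has_derivative g' i) (at t within I)"
    using assms[of _ "p _"] unfolding differentiable_def by (intro choice allI)
  then obtain g' where "\<And>i. ((\<lambda>t. f t $ i $ p i) has_derivative g' i) (at t within I)"
    by blast
  hence "((\<lambda>t. \<Prod>i\<in>UNIV. f t $ i $ p i) has_derivative
      (\<lambda>y. \<Sum>i\<in>UNIV. g' i y * (\<Prod>j\<in>UNIV - {i}. f t $ j $ p j))) (at t within I)"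
    by (intro has_derivative_prod)
  thus "(\<lambda>t. \<Prod>i\<in>UNIV. f t $ i $ p i) differentiable (at t within I)"
    unfolding differentiable_def by blast
qed (auto simp: finite_permutations)

lemma has_vector_derivative_entry:
  fixes f :: "real \<Rightarrow> real^'a^'b"
  assumes "(f has_vector_derivative f') F"
  shows "((\<lambda>t. f t $ i $ j) has_real_derivative f' $ i $ j) F"
proof -
  have "bounded_linear (\<lambda>X :: real^'a^'b. X $ i $ j)"
    by (intro bounded_linear_vec_nth bounded_linear_compose[OF bounded_linear_vec_nth])
  from bounded_linear.has_vector_derivative[OF this assms]
  show ?thesis by (simp add: has_real_derivative_iff_has_vector_derivative)
qed

text \<open>Cramer's rule shows that the entries of the inverse are quotients of polynomials in the entries of
the matrix, so that inversion preserves differentiability.\<close>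

lemma matrix_inv_entry:
  fixes X :: "real^'a^'a"
  assumes "invertible X"
  shows "matrix_inv X $ k $ l =
     det (\<chi> i j. if j = k then axis l 1 $ i else X $ i $ j) / det X"
proof -
  have d: "det X \<noteq> 0" using assms by (simp add: invertible_det_nz)
  have "X *v (matrix_inv X *v axis l 1) = axis l 1"
    by (simp add: matrix_vector_mul_assoc matrix_inv_mult[OF assms])
  hence "matrix_inv X *v axis l 1 =
      (\<chi> k. det (\<chi> i j. if j = k then axis l 1 $ i else X $ i $ j) / det X)"
    by (simp add: cramer[OF d])
  moreover have "(matrix_inv X *v axis l 1) $ k = matrix_inv X $ k $ l"
    by (simp add: matrix_vector_mult_basis column_def)
  ultimately show ?thesis by simp
qed

lemma has_vector_derivative_matrix_inv:
  fixes X :: "real \<Rightarrow> real^'a^'a"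
  assumes X: "(X has_vector_derivative X') (at t within I)"
    and inv: "\<And>s. s \<in> I \<Longrightarrow> invertible (X s)" and t: "t \<in> I"
  shows "((\<lambda>s. matrix_inv (X s)) has_vector_derivative
            - (matrix_inv (X t) ** X' ** matrix_inv (X t))) (at t within I)"
proof -
  let ?Z = "\<lambda>s. matrix_inv (X s)"
  have Xd: "(\<lambda>s. X s $ i $ j) differentiable (at t within I)" for i j
    using has_vector_derivative_entry[OF X, of i j]
    by (auto simp: has_field_derivative_def differentiable_def)
  have "(\<lambda>s. ?Z s $ k $ l) differentiable (at t within I)" for k l
  proof -
    let ?f = "\<lambda>s. det (\<chi> i j. if j = k then axis l 1 $ i else X s $ i $ j) / det (X s)"
    have d: "det (X t) \<noteq> 0" using inv[OF t] by (simp add: invertible_det_nz)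
    have "?f differentiable (at t within I)"
    proof (intro differentiable_divide differentiable_det d)
      fix i j
      show "(\<lambda>s. (\<chi> i j. if j = k then axis l 1 $ i else X s $ i $ j) $ i $ j)
              differentiable at t within I"
        by (cases "j = k") (simp_all add: Xd)
    qed (rule Xd)
    then obtain f' where f': "(?f has_derivative f') (at t within I)"
      unfolding differentiable_def by blast
    have "((\<lambda>s. ?Z s $ k $ l) has_derivative f') (at t within I)"
      by (rule has_derivative_transform[OF t _ f']) (simp add: matrix_inv_entry inv)
    thus ?thesis unfolding differentiable_def by blast
  qed
  hence "\<forall>k l. \<exists>d. ((\<lambda>s. ?Z s $ k $ l) has_real_derivative d) (at t within I)"
    by (simp add: real_differentiable_def)
  then obtain d where d: "\<And>k l. ((\<lambda>s. ?Z s $ k $ l) has_real_derivative d k l) (at t within I)"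
    by metis
  define Z' where "Z' = (\<chi> k l. d k l)"
  have Z: "(?Z has_vector_derivative Z') (at t within I)"
    by (rule has_vector_derivative_matrix) (simp add: Z'_def d)
  \<comment> \<open>On \<open>I\<close> the function \<open>?Z\<close> equals \<open>?Z t - ?Z s ** (X s - X t) ** ?Z t\<close>, and the product rule at
      \<open>t\<close> multiplies the unknown derivative \<open>Z'\<close> by \<open>X t - X t = 0\<close>.\<close>
  have "((\<lambda>s. ?Z t - ?Z s ** (X s - X t) ** ?Z t) has_vector_derivative
           0 - (?Z t ** X' + Z' ** (X t - X t)) ** ?Z t) (at t within I)"
    by (intro has_vector_derivative_diff has_vector_derivative_const
          bounded_linear.has_vector_derivative[OF matmul.bounded_linear_left]
          has_vector_derivative_matmul Z)
       (use has_vector_derivative_diff[OF X has_vector_derivative_const] in simp)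
  hence "((\<lambda>s. ?Z t - ?Z s ** (X s - X t) ** ?Z t) has_vector_derivative
           - (?Z t ** X' ** ?Z t)) (at t within I)"
    by (simp add: mat_simps)
  thus ?thesis
    by (rule has_vector_derivative_transform[OF t, rotated])
       (simp add: mat_simps matrix_inv_mult matrix_inv_cancel inv t)
qed

text \<open>This is the Gronwall argument: \<open>exp (- 2 * c * t) * (norm (E t))\<^sup>2\<close> is nonnegative, nonincreasing and
vanishes at \<open>0\<close>.\<close>

lemma linear_growth_imp_zero:
  fixes E :: "real \<Rightarrow> 'a::real_inner"
  assumes E: "\<And>t. t \<in> {0..T} \<Longrightarrow> (E has_vector_derivative E' t) (at t within {0..T})"
    and bound: "\<And>t. t \<in> {0..T} \<Longrightarrow> norm (E' t) \<le> c * norm (E t)"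
    and E0: "E 0 = 0" and T: "0 \<le> T"
  shows "E T = 0"
proof -
  let ?f = "\<lambda>t. exp (- 2 * c * t) * (E t \<bullet> E t)"
  have D: "(?f has_real_derivative
      exp (- 2 * c * t) * (2 * (E t \<bullet> E' t) - 2 * c * (E t \<bullet> E t))) (at t within {0..T})"
    if t: "t \<in> {0..T}" for t
  proof -
    have "((\<lambda>t. E t \<bullet> E t) has_real_derivative 2 * (E t \<bullet> E' t)) (at t within {0..T})"
      using bounded_bilinear.has_vector_derivative[OF bounded_bilinear_inner E[OF t] E[OF t]]
      by (simp add: has_real_derivative_iff_has_vector_derivative inner_commute)
    thus ?thesis by (auto intro!: derivative_eq_intros simp: algebra_simps)
  qed
  have "?f T \<le> ?f 0"
  proof (rule DERIV_nonpos_imp_decreasing_open[OF T])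
    show "continuous_on {0..T} ?f"
      using D by (meson DERIV_continuous continuous_on_eq_continuous_within)
    fix t assume t: "0 < t" "t < T"
    have "E t \<bullet> E' t \<le> norm (E t) * norm (E' t)" by (rule norm_cauchy_schwarz)
    also have "\<dots> \<le> norm (E t) * (c * norm (E t))"
      using bound[of t] t by (intro mult_left_mono) auto
    also have "\<dots> = c * (E t \<bullet> E t)" by (simp add: dot_square_norm power2_eq_square)
    finally have "exp (- 2 * c * t) * (2 * (E t \<bullet> E' t) - 2 * c * (E t \<bullet> E t)) \<le> 0"
      by (intro mult_nonneg_nonpos) auto
    moreover have "(?f has_real_derivative
      exp (- 2 * c * t) * (2 * (E t \<bullet> E' t) - 2 * c * (E t \<bullet> E t))) (at t)"
      using D[of t] t at_within_interior[of t "{0..T}"] by (simp add: interior_atLeastAtMost_real)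
    ultimately show "\<exists>y. (?f has_real_derivative y) (at t) \<and> y \<le> 0" by blast
  qed
  hence "E T \<bullet> E T \<le> 0" using E0 by (simp add: mult_le_0_iff)
  thus ?thesis by (metis antisym inner_eq_zero_iff inner_ge_zero)
qed

text \<open>The difference \<open>E\<close> of two solutions satisfies the linear equation
\<open>E' = (A\<^sup>T + P2 B B\<^sup>T) E + E (A + B B\<^sup>T P1)\<close>, whose coefficients are bounded on \<open>{0..T}\<close> by continuity.\<close>

lemma solves_DRE_unique:
  fixes P1 P2 :: "real \<Rightarrow> real^'k^'k"
  assumes P1: "solves_DRE A B C P0 I P1" and P2: "solves_DRE A B C P0 I P2"
    and I: "{0..T} \<subseteq> I" and T: "0 \<le> T"
  shows "P1 T = P2 T"
proof -
  define K where "K = B ** transpose B"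
  let ?r = "\<lambda>P. transpose A ** P + P ** A + P ** K ** P + transpose C ** C"
  have deriv: "(P has_vector_derivative ?r (P t)) (at t within {0..T})"
    if "solves_DRE A B C P0 I P" "t \<in> {0..T}" for P t
  proof -
    have "(P has_vector_derivative ?r (P t)) (at t within I)"
      using that I by (auto simp: solves_DRE_def K_def matrix_mul_assoc)
    thus ?thesis by (rule has_vector_derivative_within_subset) (rule I)
  qed
  have bnd: "\<exists>b\<ge>0. \<forall>t\<in>{0..T}. norm (P t) \<le> b" if "solves_DRE A B C P0 I P" for P
  proof -
    have "continuous_on {0..T} P"
      using deriv[OF that] has_vector_derivative_continuous
      by (metis continuous_on_eq_continuous_within)
    hence "bounded (P ` {0..T})" by (intro compact_imp_bounded compact_continuous_image) auto
    then obtain b where "b > 0" "\<forall>x\<in>P ` {0..T}. norm x \<le> b" unfolding bounded_pos by blast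
    thus ?thesis by (intro exI[of _ b]) auto
  qed
  from bnd[OF P1] obtain b1 where b1: "b1 \<ge> 0" "\<And>t. t \<in> {0..T} \<Longrightarrow> norm (P1 t) \<le> b1" by blast
  from bnd[OF P2] obtain b2 where b2: "b2 \<ge> 0" "\<And>t. t \<in> {0..T} \<Longrightarrow> norm (P2 t) \<le> b2" by blast
  obtain k where k: "k > 0" "\<And>(X :: real^'k^'k) (Y :: real^'k^'k). norm (X ** Y) \<le> norm X * norm Y * k"
    using matmul.pos_bounded by blast
  define c where "c = (norm (transpose A) + norm A) * k + (b1 + b2) * (norm K * k * k)"
  let ?E = "\<lambda>t. P1 t - P2 t"
  have "?E T = 0"
  proof (rule linear_growth_imp_zero[where c = c and E' = "\<lambda>t. ?r (P1 t) - ?r (P2 t)"])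
    fix t assume t: "t \<in> {0..T}"
    show "(?E has_vector_derivative ?r (P1 t) - ?r (P2 t)) (at t within {0..T})"
      by (intro has_vector_derivative_diff deriv P1 P2 t)
    have kk: "norm (X ** Y ** Z) \<le> norm X * norm Y * k * norm Z * k" for X :: "real^'k^'k" and Y :: "real^'k^'k" and Z :: "real^'k^'k"
    proof -
      have "norm (X ** Y ** Z) \<le> norm (X ** Y) * norm Z * k" by (rule k)
      also have "\<dots> \<le> norm X * norm Y * k * norm Z * k"
        by (intro mult_right_mono k(2)) (use k(1) in auto)
      finally show ?thesis .
    qed
    have "?r (P1 t) - ?r (P2 t) =
        (transpose A ** ?E t + ?E t ** A) + (?E t ** K ** P1 t + P2 t ** K ** ?E t)"
      by (simp add: mat_simps)
    also have "norm \<dots> \<le> (norm (transpose A) * norm (?E t) * k + norm (?E t) * norm A * k) +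
        (norm (?E t) * norm K * k * norm (P1 t) * k + norm (P2 t) * norm K * k * norm (?E t) * k)"
      by (intro norm_triangle_mono k kk)
    also have "\<dots> = ((norm (transpose A) + norm A) * k + (norm (P1 t) + norm (P2 t)) * (norm K * k * k)) * norm (?E t)"
      by (simp add: algebra_simps)
    also have "\<dots> \<le> c * norm (?E t)"
      unfolding c_def using b1(2)[OF t] b2(2)[OF t] k
      by (intro mult_right_mono add_left_mono add_mono) auto
    finally show "norm (?r (P1 t) - ?r (P2 t)) \<le> c * norm (?E t)" .
  qed (use P1 P2 T in \<open>auto simp: solves_DRE_def\<close>)
  thus ?thesis by simp
qed

abbreviation mat_power :: "real^'k^'k \<Rightarrow> nat \<Rightarrow> real^'k^'k" where
  "mat_power X k \<equiv> ((**) X ^^ k) (mat 1)"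

lemma mat_power_Suc_right: "mat_power X (Suc k) = mat_power X k ** X"
  by (induction k) (simp_all add: matrix_mul_assoc)

lemma mat_power_scaleR: "mat_power (t *\<^sub>R X) k = t ^ k *\<^sub>R mat_power X k"
  by (induction k) (simp_all add: matmul.scaleR_left matmul.scaleR_right)

lemma mat_exp_sums:
  fixes X :: "real^'k^'k"
  shows "(\<lambda>k. (t ^ k / fact k) *\<^sub>R mat_power X k) sums mat_exp (t *\<^sub>R X)"
proof -
  obtain b where b: "b > 0" "\<And>(Y :: real^'k^'k) (Z :: real^'k^'k). norm (Y ** Z) \<le> norm Y * norm Z * b"
    using matmul.pos_bounded by blast
  define r where "r = norm X * b"
  have pw: "norm (mat_power X k) \<le> norm (mat 1 :: real^'k^'k) * r ^ k" for k
  proof (induction k)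
    case (Suc k)
    have "norm (mat_power X (Suc k)) \<le> norm X * norm (mat_power X k) * b"
      using b(2) by simp
    also have "\<dots> = r * norm (mat_power X k)" by (simp add: r_def)
    also have "\<dots> \<le> r * (norm (mat 1 :: real^'k^'k) * r ^ k)"
      using b(1) by (intro mult_left_mono Suc) (simp add: r_def)
    finally show ?case by (simp add: mult_ac)
  qed simp
  have "summable (\<lambda>k. norm (mat 1 :: real^'k^'k) * ((\<bar>t\<bar> * r) ^ k /\<^sub>R fact k))"
    by (intro summable_mult summable_exp_generic)
  hence "summable (\<lambda>k. (t ^ k / fact k) *\<^sub>R mat_power X k)"
  proof (rule summable_comparison_test'[where N = 0])
    fix k
    have "norm ((t ^ k / fact k) *\<^sub>R mat_power X k) = \<bar>t\<bar> ^ k / fact k * norm (mat_power X k)"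
      by (simp add: power_abs)
    also have "\<dots> \<le> \<bar>t\<bar> ^ k / fact k * (norm (mat 1 :: real^'k^'k) * r ^ k)"
      by (intro mult_left_mono pw) auto
    finally show "norm ((t ^ k / fact k) *\<^sub>R mat_power X k)
        \<le> norm (mat 1 :: real^'k^'k) * ((\<bar>t\<bar> * r) ^ k /\<^sub>R fact k)"
      by (simp add: power_mult_distrib field_simps)
  qed
  thus ?thesis by (simp add: mat_exp_def mat_power_scaleR summable_sums_iff)
qed

lemma mat_exp_zero: "mat_exp (0 *\<^sub>R X) = mat 1"
proof -
  have "(\<lambda>k. (0 ^ k / fact k) *\<^sub>R mat_power X k) = (\<lambda>k. if k = 0 then mat 1 else 0)"
    by (auto simp: fun_eq_iff)
  thus ?thesis using mat_exp_sums[of 0 X] sums_If_finite_set[of "{0::nat}" "\<lambda>_. mat 1 :: real^'a^'a"]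
    by (simp add: sums_unique2)
qed

text \<open>Each entry of \<open>mat_exp (t *\<^sub>R X)\<close> is an everywhere convergent real power series in \<open>t\<close> and can be
differentiated term by term.\<close>

lemma has_vector_derivative_mat_exp:
  "((\<lambda>t. mat_exp (t *\<^sub>R X)) has_vector_derivative X ** mat_exp (t *\<^sub>R X)) (at t)"
proof (rule has_vector_derivative_matrix)
  fix i j
  define c where "c k = mat_power X k $ i $ j / fact k" for k
  have ent: "(\<lambda>k. Y k $ i $ j) sums (l $ i $ j)" if "Y sums l" for Y :: "nat \<Rightarrow> real^'a^'a" and l
    using that by (intro sums_vec_nth)
  have c: "(\<lambda>k. c k * s ^ k) sums (mat_exp (s *\<^sub>R X) $ i $ j)" for s
    using ent[OF mat_exp_sums[of s X]] by (simp add: c_def mult_ac)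
  have "(\<lambda>k. X ** ((t ^ k / fact k) *\<^sub>R mat_power X k)) sums (X ** mat_exp (t *\<^sub>R X))"
    by (intro bounded_linear.sums[OF matmul.bounded_linear_right] mat_exp_sums)
  from ent[OF this] have "(\<lambda>k. diffs c k * t ^ k) sums ((X ** mat_exp (t *\<^sub>R X)) $ i $ j)"
    by (simp add: diffs_def c_def matmul.scaleR_right mult_ac del: of_nat_Suc)
  moreover have "((\<lambda>s. \<Sum>k. c k * s ^ k) has_real_derivative (\<Sum>k. diffs c k * t ^ k)) (at t)"
    using c by (intro termdiffs_strong_converges_everywhere) (auto simp: summable_def)
  moreover have "(\<Sum>k. c k * s ^ k) = mat_exp (s *\<^sub>R X) $ i $ j" for s
    using sums_unique[OF c] by simp
  ultimately show "((\<lambda>t. mat_exp (t *\<^sub>R X) $ i $ j) has_real_derivative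
      (X ** mat_exp (t *\<^sub>R X)) $ i $ j) (at t)"
    by (simp add: sums_unique[symmetric])
qed

section \<open>Block matrices\<close>

definition blk21 :: "real^('a::finite + 'b::finite)^('c::finite + 'd::finite) \<Rightarrow> real^'a^'d" where
  "blk21 U = (\<chi> i j. U $ Inr i $ Inl j)"

lemma sum_UNIV_plus: "(\<Sum>i\<in>UNIV. f i) = (\<Sum>i\<in>UNIV. f (Inl i)) + (\<Sum>i\<in>UNIV. f (Inr i))"
  for f :: "'a::finite + 'b::finite \<Rightarrow> real"
  by (simp add: UNIV_Plus_UNIV[symmetric] sum.Plus del: UNIV_Plus_UNIV)

lemmas block_entries = block4_def vblock_def hblock_def blk11_def blk12_def blk21_def blk22_def

lemma blk_block4 [simp]:
  "blk11 (block4 X11 X12 X21 X22) = X11" "blk12 (block4 X11 X12 X21 X22) = X12"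
  "blk21 (block4 X11 X12 X21 X22) = X21" "blk22 (block4 X11 X12 X21 X22) = X22"
  by (simp_all add: block_entries vec_eq_iff)

lemma block4_mult:
  "block4 X11 X12 X21 X22 ** block4 Y11 Y12 Y21 Y22 =
   block4 (X11 ** Y11 + X12 ** Y21) (X11 ** Y12 + X12 ** Y22)
          (X21 ** Y11 + X22 ** Y21) (X21 ** Y12 + X22 ** Y22)"
  by (simp add: block_entries vec_eq_iff matrix_matrix_mult_def sum_UNIV_plus split: sum.split)

lemma blk_mult:
  fixes U :: "real^('a::finite + 'b::finite)^('c::finite + 'd::finite)"
    and V :: "real^('e::finite + 'f::finite)^('a + 'b)"
  shows "blk11 (U ** V) = blk11 U ** blk11 V + blk12 U ** blk21 V"
    and "blk12 (U ** V) = blk11 U ** blk12 V + blk12 U ** blk22 V"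
    and "blk21 (U ** V) = blk21 U ** blk11 V + blk22 U ** blk21 V"
    and "blk22 (U ** V) = blk21 U ** blk12 V + blk22 U ** blk22 V"
  by (simp_all add: block_entries vec_eq_iff matrix_matrix_mult_def sum_UNIV_plus)

lemma block4_add:
  "block4 X11 X12 X21 X22 + block4 Y11 Y12 Y21 Y22 =
   block4 (X11 + Y11) (X12 + Y12) (X21 + Y21) (X22 + Y22)"
  by (simp add: block_entries vec_eq_iff split: sum.split)

lemma block4_one: "(mat 1 :: real^('a::finite+'b::finite)^('a+'b)) = block4 (mat 1) 0 0 (mat 1)"
  by (simp add: block_entries vec_eq_iff mat_def split: sum.split)

lemma transpose_block4:
  "transpose (block4 X11 X12 X21 X22) =
   block4 (transpose X11) (transpose X21) (transpose X12) (transpose X22)"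
  by (simp add: block_entries vec_eq_iff transpose_def split: sum.split)

lemma vblock_mult_transpose:
  "vblock X Y ** transpose (vblock V W) =
   block4 (X ** transpose V) (X ** transpose W) (Y ** transpose V) (Y ** transpose W)"
  by (simp add: block_entries vec_eq_iff matrix_matrix_mult_def transpose_def split: sum.split)

lemma transpose_hblock_mult:
  "transpose (hblock X Y) ** hblock V W =
   block4 (transpose X ** V) (transpose X ** W) (transpose Y ** V) (transpose Y ** W)"
  by (simp add: block_entries vec_eq_iff matrix_matrix_mult_def transpose_def split: sum.split)

lemma has_vector_derivative_block4:
  assumes "(X11 has_vector_derivative Y11) (at t within I)"
    and "(X12 has_vector_derivative Y12) (at t within I)"
    and "(X21 has_vector_derivative Y21) (at t within I)"
    and "(X22 has_vector_derivative Y22) (at t within I)"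
  shows "((\<lambda>t. block4 (X11 t) (X12 t) (X21 t) (X22 t)) has_vector_derivative
      block4 Y11 Y12 Y21 Y22) (at t within I)"
proof (rule has_vector_derivative_matrix)
  fix i j
  show "((\<lambda>t. block4 (X11 t) (X12 t) (X21 t) (X22 t) $ i $ j) has_real_derivative
      block4 Y11 Y12 Y21 Y22 $ i $ j) (at t within I)"
    using assms[THEN has_vector_derivative_entry]
    by (cases i; cases j) (simp_all add: block_entries)
qed

lemma has_vector_derivative_blk:
  assumes "(U has_vector_derivative V) (at t within I)"
  shows "((\<lambda>t. blk11 (U t)) has_vector_derivative blk11 V) (at t within I)"
    and "((\<lambda>t. blk12 (U t)) has_vector_derivative blk12 V) (at t within I)"
    and "((\<lambda>t. blk21 (U t)) has_vector_derivative blk21 V) (at t within I)"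
    and "((\<lambda>t. blk22 (U t)) has_vector_derivative blk22 V) (at t within I)"
  by (intro has_vector_derivative_matrix;
      use has_vector_derivative_entry[OF assms] in \<open>simp add: block_entries\<close>)+

section \<open>Positive definite matrices\<close>

lemma bounded_bilinear_matrix_vector_mult:
  "bounded_bilinear ((*v) :: real^'a^'b \<Rightarrow> real^'a \<Rightarrow> real^'b)"
  by (subst bilinear_conv_bounded_bilinear[symmetric])
     (simp add: bilinear_def linear_iff matrix_vector_mult_def vec_eq_iff sum.distrib
        algebra_simps sum_distrib_left)

interpretation matvec: bounded_bilinear "(*v) :: real^'a^'b \<Rightarrow> real^'a \<Rightarrow> real^'b"
  by (rule bounded_bilinear_matrix_vector_mult)

lemma dot_mult_transpose: "x \<bullet> (X *v y) = (transpose X *v x) \<bullet> y" for X :: "real^'a^'b"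
  by (simp add: dot_lmul_matrix)

lemma pos_def_invertible:
  assumes "pos_def X"
  shows "invertible X"
proof -
  have "v = 0" if "X *v v = 0" for v
    using assms that unfolding pos_def_def by (metis inner_zero_right less_irrefl)
  thus ?thesis using matrix_left_invertible_ker invertible_left_inverse by blast
qed

lemma neg_def_invertible: "neg_def X \<Longrightarrow> invertible X"
  using invertible_minus[of "- X"] pos_def_invertible[of "- X"] by (simp add: neg_def_def)

lemma pos_def_nonneg:
  assumes "pos_def X"
  shows "v \<bullet> (X *v v) \<ge> 0"
  using assms unfolding pos_def_def by (cases "v = 0") (auto intro: less_imp_le)

lemma pos_def_matrix_inv:
  assumes "pos_def X"
  shows "pos_def (matrix_inv X)"
proof -
  note inv = pos_def_invertible[OF assms]
  have X: "transpose X = X" using assms by (simp add: pos_def_def)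
  have sym: "transpose (matrix_inv X) = matrix_inv X"
    by (simp add: transpose_matrix_inv inv X)
  moreover have "v \<bullet> (matrix_inv X *v v) > 0" if "v \<noteq> 0" for v
  proof -
    let ?w = "matrix_inv X *v v"
    have v: "v = X *v ?w" by (simp add: matrix_vector_mul_assoc matrix_inv_mult inv)
    hence "?w \<noteq> 0" using that by auto
    hence "?w \<bullet> (X *v ?w) > 0" using assms by (simp add: pos_def_def)
    thus ?thesis using v by (simp add: inner_commute)
  qed
  ultimately show ?thesis by (simp add: pos_def_def)
qed

text \<open>Inversion reverses the order of positive definite matrices. With \<open>x = X\<^sup>-\<^sup>1 v\<close> and \<open>y = Y\<^sup>-\<^sup>1 v\<close>, the form
of \<open>Y\<^sup>-\<^sup>1 - X\<^sup>-\<^sup>1\<close> at \<open>v\<close> is the form of \<open>X - Y\<close> at \<open>x\<close> plus the form of \<open>Y\<close> at \<open>x - y\<close>.\<close>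

lemma pos_def_matrix_inv_diff:
  assumes X: "pos_def X" and Y: "pos_def Y" and XY: "pos_def (X - Y)"
  shows "pos_def (matrix_inv Y - matrix_inv X)"
  unfolding pos_def_def
proof (intro conjI allI impI)
  note iX = pos_def_invertible[OF X] and iY = pos_def_invertible[OF Y]
  have sX: "transpose X = X" and sY: "transpose Y = Y" using X Y by (simp_all add: pos_def_def)
  show "transpose (matrix_inv Y - matrix_inv X) = matrix_inv Y - matrix_inv X"
    by (simp add: transpose_arith transpose_matrix_inv iX iY sX sY)
  fix v :: "real^'a" assume v: "v \<noteq> 0"
  define x where "x = matrix_inv X *v v"
  define y where "y = matrix_inv Y *v v"
  have vx: "v = X *v x" and vy: "v = Y *v y"
    by (simp_all add: x_def y_def matrix_vector_mul_assoc matrix_inv_mult iX iY)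
  have "x \<noteq> 0" using v vx by auto
  hence "0 < x \<bullet> ((X - Y) *v x)" using XY by (simp add: pos_def_def)
  also have "\<dots> = x \<bullet> v - x \<bullet> (Y *v x)"
    by (subst vx) (simp add: matrix_vector_mult_diff_rdistrib inner_diff_right)
  also have "\<dots> \<le> x \<bullet> v - x \<bullet> (Y *v x) + (x - y) \<bullet> (Y *v (x - y))"
    using pos_def_nonneg[OF Y] by simp
  also have "\<dots> = y \<bullet> v - x \<bullet> v"
  proof -
    have "y \<bullet> (Y *v x) = (Y *v y) \<bullet> x" by (metis dot_mult_transpose sY)
    hence "y \<bullet> (Y *v x) = v \<bullet> x" by (simp flip: vy)
    thus ?thesis
      by (simp add: matrix_vector_mult_diff_distrib inner_diff_right inner_diff_left
            flip: vy) (simp add: inner_commute)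
  qed
  also have "\<dots> = v \<bullet> ((matrix_inv Y - matrix_inv X) *v v)"
    by (simp add: matrix_vector_mult_diff_rdistrib inner_diff_right x_def y_def inner_commute)
  finally show "0 < v \<bullet> ((matrix_inv Y - matrix_inv X) *v v)" .
qed

text \<open>A nonnegative form is minimal at its null vectors, so its gradient \<open>2 X v\<close> vanishes there.\<close>

lemma nonneg_kernel:
  fixes X :: "real^'a^'a"
  assumes sym: "transpose X = X" and nn: "\<And>v. v \<bullet> (X *v v) \<ge> 0" and v: "v \<bullet> (X *v v) = 0"
  shows "X *v v = 0"
proof (rule ccontr)
  assume nz: "X *v v \<noteq> 0"
  define w where "w = X *v v"
  define q where "q = w \<bullet> (X *v w)"
  have vw: "v \<bullet> (X *v w) = w \<bullet> w" by (metis dot_mult_transpose sym w_def)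
  have w: "w \<bullet> w > 0" using nz by (simp add: w_def)
  have "0 \<le> (v + s *\<^sub>R w) \<bullet> (X *v (v + s *\<^sub>R w))" for s by (rule nn)
  also have "(v + s *\<^sub>R w) \<bullet> (X *v (v + s *\<^sub>R w)) = 2 * s * (w \<bullet> w) + s * s * q" for s
    using v vw by (simp add: matrix_vector_right_distrib matrix_vector_mult_scaleR
        inner_add_left inner_add_right q_def w_def algebra_simps)
  finally have ineq: "0 \<le> 2 * s * (w \<bullet> w) + s * s * q" for s .
  have q: "q \<ge> 0" unfolding q_def by (rule nn)
  \<comment> \<open>Near \<open>v\<close> in the direction \<open>- w\<close> the form would be negative; the step \<open>e * (w \<bullet> w)\<close> is short enough
      for the linear term to dominate the quadratic one.\<close>
  define e where "e = 1 / (q + 1)"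
  have e: "e > 0" "e * q = 1 - e" using q by (simp_all add: e_def field_simps)
  have "0 \<le> 2 * (- (w \<bullet> w) * e) * (w \<bullet> w) + (w \<bullet> w) * (w \<bullet> w) * e * (e * q)"
    using ineq[of "- (w \<bullet> w) * e"] by (simp add: mult_ac)
  also have "\<dots> = - ((w \<bullet> w) * (w \<bullet> w) * (e * (1 + e)))"
    unfolding e(2) by (simp add: algebra_simps)
  also have "\<dots> < 0" using w e by (intro neg_less_0_iff_less[THEN iffD2] mult_pos_pos) auto
  finally show False by simp
qed

text \<open>Positive definiteness can only be lost through a singular matrix. Among all times at which the form
is not positive somewhere on the unit sphere there is, by compactness, a first one \<open>s\<close>; there the
form is nonnegative as a limit but vanishes at some unit vector, which then lies in the kernel of
\<open>N s\<close>.\<close>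

lemma pos_def_path:
  fixes N :: "real \<Rightarrow> real^'a^'a"
  assumes cont: "continuous_on {0..T} N" and T: "0 \<le> T"
    and N0: "pos_def (N 0)" and sym: "\<And>s. s \<in> {0..T} \<Longrightarrow> transpose (N s) = N s"
    and inv: "\<And>s. s \<in> {0..T} \<Longrightarrow> invertible (N s)"
  shows "pos_def (N T)"
proof (rule ccontr)
  assume nT: "\<not> pos_def (N T)"
  let ?f = "\<lambda>(s, v). v \<bullet> (N s *v v)"
  let ?D = "{0..T} \<times> sphere (0 :: real^'a) 1"
  define K where "K = {p \<in> ?D. ?f p \<le> 0}"
  have scale: "\<exists>u. norm u = 1 \<and> u \<bullet> (X *v u) \<le> 0" if "v \<noteq> 0" "v \<bullet> (X *v v) \<le> 0"
    for X :: "real^'a^'a" and v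
  proof (intro exI conjI)
    let ?u = "(1 / norm v) *\<^sub>R v"
    show "norm ?u = 1" using that by simp
    show "?u \<bullet> (X *v ?u) \<le> 0"
      using that by (simp add: matrix_vector_mult_scaleR divide_le_0_iff)
  qed
  have K: "\<exists>v. (s, v) \<in> K" if sT: "s \<in> {0..T}" and np: "\<not> pos_def (N s)" for s
  proof -
    obtain v where "v \<noteq> 0" "v \<bullet> (N s *v v) \<le> 0"
      using np sym[OF sT] unfolding pos_def_def by (meson not_less)
    from scale[OF this(1,2)] show ?thesis using sT by (auto simp: K_def)
  qed
  have "continuous_on ?D (\<lambda>p. snd p \<bullet> (N (fst p) *v snd p))"
    by (intro continuous_on_inner matvec.continuous_on continuous_on_snd continuous_on_id
          continuous_on_compose2[OF cont continuous_on_fst]) auto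
  hence contf: "continuous_on ?D ?f" by (simp add: case_prod_beta)
  have "K = ?D \<inter> ?f -` {..0}" by (auto simp: K_def)
  hence "closed K"
    using continuous_closed_preimage[OF contf] by (simp add: closed_Times)
  moreover have "bounded K"
    by (rule bounded_subset[of ?D]) (auto simp: K_def intro!: bounded_Times)
  ultimately have "compact K" by (simp add: compact_eq_bounded_closed)
  moreover have "K \<noteq> {}" using K[of T] nT T by auto
  ultimately obtain s v where sv: "(s, v) \<in> K" and min: "\<And>s' v'. (s', v') \<in> K \<Longrightarrow> s \<le> s'"
    using continuous_attains_inf[of K fst] by (fastforce intro: continuous_intros)
  hence s: "s \<in> {0..T}" and v: "norm v = 1" "v \<bullet> (N s *v v) \<le> 0" by (auto simp: K_def)
  have "v \<noteq> 0" using v by auto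
  have "s \<noteq> 0" using N0 v \<open>v \<noteq> 0\<close> unfolding pos_def_def by (metis not_less)
  have before: "pos_def (N r)" if "r \<in> {0..<s}" for r
    using K[of r] min that s by force
  have nn: "w \<bullet> (N s *v w) \<ge> 0" for w
  proof (rule tendsto_lowerbound)
    show "((\<lambda>r. w \<bullet> (N r *v w)) \<longlongrightarrow> w \<bullet> (N s *v w)) (at s within {0..<s})"
    proof -
      have "(N \<longlongrightarrow> N s) (at s within {0..<s})"
        by (rule tendsto_within_subset[of N _ s "{0..T}"]) (use cont s in \<open>auto simp: continuous_on_def\<close>)
      thus ?thesis by (intro tendsto_inner matvec.tendsto tendsto_const)
    qed
    show "\<forall>\<^sub>F r in at s within {0..<s}. 0 \<le> w \<bullet> (N r *v w)"
      unfolding eventually_at_filter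
      by (rule always_eventually) (use before pos_def_nonneg in blast)
    show "at s within {0..<s} \<noteq> bot"
      using s \<open>s \<noteq> 0\<close> by (simp add: at_within_eq_bot_iff closure_atLeastLessThan)
  qed
  have "N s *v v = 0"
    using nn[of v] v(2) by (intro nonneg_kernel sym s nn) auto
  hence "matrix_inv (N s) *v (N s *v v) = 0" by simp
  thus False
    using \<open>v \<noteq> 0\<close> by (simp add: matrix_vector_mul_assoc matrix_inv_mult inv[OF s])
qed

section \<open>The Hamiltonian flow\<close>

text \<open>The adjoint is moved across inner products below, so \<open>transpose A *v x\<close> has to survive simplification
instead of becoming \<open>x v* A\<close>.\<close>

declare transpose_matrix_vector [simp del] vector_transpose_matrix [simp del]

locale riccati =
  fixes A :: "real^'n^'n" and B :: "real^'m^'n" and C :: "real^'n^'p"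
begin

definition "K = B ** transpose B"
definition "W = transpose C ** C"

lemma sym_K: "transpose K = K" and sym_W: "transpose W = W"
  by (simp_all add: K_def W_def matrix_transpose_mul)

definition hamilton_pair :: "(real \<Rightarrow> real^'n^'n) \<Rightarrow> (real \<Rightarrow> real^'n^'n) \<Rightarrow> bool" where
  "hamilton_pair X Y \<longleftrightarrow>
     (\<forall>t. (X has_vector_derivative - (A ** X t) - K ** Y t) (at t) \<and>
          (Y has_vector_derivative W ** X t + transpose A ** Y t) (at t))"

text \<open>The flow preserves the symplectic form. The symmetry of Riccati solutions and the derivative of the
gramian \<open>G\<close> below both come from this invariant.\<close>

lemma wronskian_constant:
  assumes "hamilton_pair X1 Y1" "hamilton_pair X2 Y2"
  shows "transpose (X1 t) ** Y2 t - transpose (Y1 t) ** X2 t =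
         transpose (X1 0) ** Y2 0 - transpose (Y1 0) ** X2 0"
proof -
  have "((\<lambda>t. transpose (X1 t) ** Y2 t - transpose (Y1 t) ** X2 t) has_vector_derivative
      (transpose (X1 s) ** (W ** X2 s + transpose A ** Y2 s)
        + transpose (- (A ** X1 s) - K ** Y1 s) ** Y2 s)
      - (transpose (Y1 s) ** (- (A ** X2 s) - K ** Y2 s)
        + transpose (W ** X1 s + transpose A ** Y1 s) ** X2 s)) (at s within UNIV)" for s
    using assms unfolding hamilton_pair_def
    by (intro has_vector_derivative_diff has_vector_derivative_matmul
          has_vector_derivative_transpose) auto
  hence "((\<lambda>t. transpose (X1 t) ** Y2 t - transpose (Y1 t) ** X2 t) has_vector_derivative 0)
      (at s within UNIV)" for s
    by (simp add: mat_simps sym_K sym_W)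
  from has_vector_derivative_zero_constant[OF convex_UNIV this]
  show ?thesis by (metis UNIV_I)
qed

text \<open>The two halves of \<open>\<Sigma>\<^sub>t [I; P]\<close>; the maximal horizon is the time up to which \<open>flowX P\<close> stays invertible.\<close>

definition "flowX P t = blk11 (symplectic_flow A B C t) + blk12 (symplectic_flow A B C t) ** P"
definition "flowY P t = blk21 (symplectic_flow A B C t) + blk22 (symplectic_flow A B C t) ** P"

lemma symplectic_flow_0: "symplectic_flow A B C 0 = block4 (mat 1) 0 0 (mat 1)"
  using mat_exp_zero[of "hamiltonian A B C"] by (simp add: symplectic_flow_def block4_one)

lemma has_vector_derivative_symplectic_flow:
  "(symplectic_flow A B C has_vector_derivative
      hamiltonian A B C ** symplectic_flow A B C t) (at t)"
  using has_vector_derivative_mat_exp[of "hamiltonian A B C" t]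
  by (simp add: symplectic_flow_def[abs_def])

lemmas blk_hamiltonian = hamiltonian_def K_def[symmetric] W_def[symmetric]

lemma hamilton_pair_right:
  "hamilton_pair (\<lambda>t. blk12 (symplectic_flow A B C t)) (\<lambda>t. blk22 (symplectic_flow A B C t))"
  unfolding hamilton_pair_def
  using has_vector_derivative_blk[OF has_vector_derivative_symplectic_flow]
  by (simp add: blk_mult blk_hamiltonian mat_simps)

lemma hamilton_pair_flow: "hamilton_pair (flowX P) (flowY P)"
  unfolding hamilton_pair_def
proof (intro allI conjI)
  fix t
  note D = has_vector_derivative_blk[OF has_vector_derivative_symplectic_flow[of t]]
  note R = bounded_linear.has_vector_derivative[OF matmul.bounded_linear_left]
  show "(flowX P has_vector_derivative - (A ** flowX P t) - K ** flowY P t) (at t)"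
    using has_vector_derivative_add[OF D(1) R[OF D(2), of P]]
    by (simp add: flowX_def[abs_def] flowY_def blk_mult blk_hamiltonian mat_simps algebra_simps)
  show "(flowY P has_vector_derivative W ** flowX P t + transpose A ** flowY P t) (at t)"
    using has_vector_derivative_add[OF D(3) R[OF D(4), of P]]
    by (simp add: flowX_def flowY_def[abs_def] blk_mult blk_hamiltonian mat_simps algebra_simps)
qed

lemma flow_0: "flowX P 0 = mat 1" "flowY P 0 = P"
  by (simp_all add: flowX_def flowY_def symplectic_flow_0 mat_simps)

text \<open>The flow is affine in the initial value: this is how a solution from \<open>P\<close> is compared with the one from
the reference value \<open>M\<close>.\<close>

lemma flow_shift:
  "flowX P t = flowX M t + blk12 (symplectic_flow A B C t) ** (P - M)"
  "flowY P t = flowY M t + blk22 (symplectic_flow A B C t) ** (P - M)"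
  by (simp_all add: flowX_def flowY_def mat_simps)

text \<open>The classical linearization of the Riccati equation: where \<open>flowX P t\<close> is invertible, the columns of
\<open>[I; riccati_curve P t]\<close> span the image of those of \<open>[I; P]\<close> under the Hamiltonian flow.\<close>

definition "riccati_curve P t = flowY P t ** matrix_inv (flowX P t)"

lemma riccati_curve_flow: "invertible (flowX P t) \<Longrightarrow> riccati_curve P t ** flowX P t = flowY P t"
  by (simp add: riccati_curve_def matrix_inv_cancel)

lemma riccati_curve_sym:
  assumes P: "transpose P = P" and inv: "invertible (flowX P t)"
  shows "transpose (riccati_curve P t) = riccati_curve P t"
proof -
  let ?X = "flowX P t" and ?Y = "flowY P t"
  have XY: "transpose ?X ** ?Y = transpose ?Y ** ?X"
    using wronskian_constant[OF hamilton_pair_flow[of P] hamilton_pair_flow[of P], of t] P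
    by (simp add: flow_0)
  have iT: "invertible (transpose ?X)" using inv by (simp add: transpose_invertible)
  have "transpose (riccati_curve P t) = matrix_inv (transpose ?X) ** (transpose ?Y ** ?X) ** matrix_inv ?X"
    by (simp add: riccati_curve_def matrix_transpose_mul transpose_matrix_inv inv mat_simps matrix_inv_cancel)
  also have "\<dots> = riccati_curve P t"
    by (simp add: riccati_curve_def mat_simps matrix_inv_mult[OF iT] flip: XY)
  finally show ?thesis .
qed

lemma has_vector_derivative_flow_inv:
  assumes "\<And>s. s \<in> I \<Longrightarrow> invertible (flowX P s)" and "t \<in> I"
  shows "((\<lambda>s. matrix_inv (flowX P s)) has_vector_derivative
     matrix_inv (flowX P t) ** A + matrix_inv (flowX P t) ** K ** riccati_curve P t) (at t within I)"
proof -
  have "(flowX P has_vector_derivative - (A ** flowX P t) - K ** flowY P t) (at t within I)"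
    using hamilton_pair_flow by (auto simp: hamilton_pair_def intro: has_vector_derivative_at_within)
  from has_vector_derivative_matrix_inv[OF this assms] show ?thesis
    by (simp add: mat_simps matrix_inv_cancel riccati_curve_def assms add.commute)
qed

lemma has_vector_derivative_riccati_curve:
  assumes inv: "\<And>s. s \<in> I \<Longrightarrow> invertible (flowX P s)" and t: "t \<in> I"
  shows "(riccati_curve P has_vector_derivative
     transpose A ** riccati_curve P t + riccati_curve P t ** A + riccati_curve P t ** K ** riccati_curve P t + W) (at t within I)"
proof -
  have "(flowY P has_vector_derivative W ** flowX P t + transpose A ** flowY P t) (at t within I)"
    using hamilton_pair_flow by (auto simp: hamilton_pair_def intro: has_vector_derivative_at_within)
  from has_vector_derivative_matmul[OF this has_vector_derivative_flow_inv[OF assms]]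
  show ?thesis
    by (simp add: riccati_curve_def[abs_def] mat_simps matrix_inv_mult matrix_inv_cancel inv t algebra_simps)
qed

lemma riccati_curve_solves_DRE:
  assumes "\<And>s. s \<in> I \<Longrightarrow> invertible (flowX P s)"
  shows "solves_DRE A B C P I (riccati_curve P)"
proof -
  have "matrix_inv (mat 1 :: real^'n^'n) = mat 1" by (rule matrix_inv_eqI) simp
  thus ?thesis using has_vector_derivative_riccati_curve[OF assms]
    by (simp add: solves_DRE_def K_def W_def matrix_mul_assoc) (simp add: riccati_curve_def flow_0)
qed

lemma horizon_less:
  assumes "ereal t < max_horizon A B C P" "0 \<le> s" "s \<le> t"
  shows "invertible (flowX P s)"
proof (cases "s = 0")
  case False
  from assms(1) obtain r where r: "t < r" "\<forall>s\<in>{0<..r}. invertible (flowX P s)"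
    unfolding max_horizon_def less_Sup_iff flowX_def by auto
  thus ?thesis using assms False by auto
qed (simp add: flow_0 matrix_inv_eqI(1)[of "mat 1" "mat 1"])

text \<open>The determinant of \<open>flowX P\<close> is continuous and equals \<open>1\<close> at \<open>0\<close>.\<close>

lemma horizon_pos: "0 < max_horizon A B C P"
proof -
  have "(\<lambda>s. det (flowX P s)) differentiable (at 0 within UNIV)"
  proof (rule differentiable_det)
    fix i j
    have "(flowX P has_vector_derivative - (A ** flowX P 0) - K ** flowY P 0) (at 0)"
      using hamilton_pair_flow by (auto simp: hamilton_pair_def)
    from has_vector_derivative_entry[OF this, of i j]
    show "(\<lambda>s. flowX P s $ i $ j) differentiable (at 0 within UNIV)"
      unfolding has_field_derivative_def differentiable_def by blast
  qed
  hence "isCont (\<lambda>s. det (flowX P s)) 0" using differentiable_imp_continuous_within by blast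
  hence "\<forall>\<^sub>F s in at 0. det (flowX P s) > 0"
    unfolding isCont_def by (rule order_tendstoD) (simp add: flow_0)
  then obtain d where d: "d > 0" "\<And>s. s \<noteq> 0 \<Longrightarrow> dist s 0 < d \<Longrightarrow> det (flowX P s) > 0"
    unfolding eventually_at by auto
  have inv: "invertible (flowX P s)" if "s \<in> {0<..d/2}" for s
    using d(2)[of s] d(1) that by (simp add: invertible_det_nz dist_real_def)
  hence "ereal (d/2) \<le> max_horizon A B C P"
    unfolding max_horizon_def using d(1) inv
    by (intro Sup_upper image_eqI[OF refl]) (simp flip: flowX_def)
  thus ?thesis using d(1) by (metis ereal_less(2) half_gt_zero less_le_trans)
qed

end

section \<open>Controllability and the dual observability condition\<close>

text \<open>Steer \<open>v\<close> to \<open>0\<close> and test the trajectory against \<open>y s = exp (- s A\<^sup>T) v\<close>. The product \<open>y \<bullet> x\<close> has derivative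
\<open>B\<^sup>T y \<bullet> u\<close>, and \<open>B\<^sup>T y = 0\<close> term by term in the exponential series, so the product keeps its initial
value \<open>v \<bullet> v\<close> although it ends at \<open>0\<close>.\<close>

lemma controllable_imp_observable_dual:
  assumes ctrl: "controllable A B"
    and v: "\<And>k. transpose B *v (mat_power (transpose A) k *v v) = 0"
  shows "v = 0"
proof -
  from ctrl obtain T u x where T: "T > 0"
    and x: "\<And>t. t \<in> {0..T} \<Longrightarrow> (x has_vector_derivative (A *v x t + B *v u t)) (at t within {0..T})"
    and x0: "x 0 = v" and xT: "x T = 0"
    unfolding controllable_def by meson
  define y where "y s = mat_exp (s *\<^sub>R (- transpose A)) *v v" for s
  have By: "transpose B *v y s = 0" for s
  proof -
    have "(\<lambda>k. transpose B *v (((s ^ k / fact k) *\<^sub>R mat_power (- transpose A) k) *v v)) sums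
        (transpose B *v y s)"
      unfolding y_def
      by (intro bounded_linear.sums[OF matvec.bounded_linear_right]
            bounded_linear.sums[OF matvec.bounded_linear_left] mat_exp_sums)
    moreover have "transpose B *v (((s ^ k / fact k) *\<^sub>R mat_power (- transpose A) k) *v v) = 0" for k
      using mat_power_scaleR[where t = "-1" and X = "transpose A" and k = k]
      by (simp add: matvec.scaleR_left matvec.scaleR_right v)
    ultimately show ?thesis by (simp add: sums_unique2[OF _ sums_zero])
  qed
  have y: "(y has_vector_derivative - (transpose A *v y s)) (at s within {0..T})" for s
  proof -
    have "(y has_vector_derivative (- transpose A ** mat_exp (s *\<^sub>R (- transpose A))) *v v) (at s)"
      unfolding y_def[abs_def]
      by (intro bounded_linear.has_vector_derivative[OF matvec.bounded_linear_left]
            has_vector_derivative_mat_exp)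
    thus ?thesis
      by (rule has_vector_derivative_at_within[OF back_subst[of "\<lambda>D. (y has_vector_derivative D) (at s)"]])
         (simp add: y_def matmul.minus_left matvec.minus_left flip: matrix_vector_mul_assoc)
  qed
  have "((\<lambda>s. y s \<bullet> x s) has_vector_derivative 0) (at s within {0..T})" if s: "s \<in> {0..T}" for s
  proof -
    have "((\<lambda>s. y s \<bullet> x s) has_vector_derivative
        y s \<bullet> (A *v x s + B *v u s) + (- (transpose A *v y s)) \<bullet> x s) (at s within {0..T})"
      by (rule bounded_bilinear.has_vector_derivative[OF bounded_bilinear_inner y x[OF s]])
    thus ?thesis
      by (simp add: inner_add_right dot_mult_transpose By)
  qed
  then obtain c where "\<And>s. s \<in> {0..T} \<Longrightarrow> y s \<bullet> x s = c"
    using has_vector_derivative_zero_constant[of "{0..T}" "\<lambda>s. y s \<bullet> x s"] by auto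
  from this[of 0] this[of T] have "y 0 \<bullet> v = 0" using T x0 xT by simp
  thus ?thesis using mat_exp_zero[of "- transpose A"] by (simp add: y_def)
qed

section \<open>A globally defined reference solution\<close>

locale riccati_global = riccati A B C
  for A :: "real^'n^'n" and B :: "real^'m^'n" and C :: "real^'n^'p" +
  fixes M :: "real^'n^'n"
  assumes M_sym: "transpose M = M" and M_inv: "invertible M"
    and flow_inv: "\<And>t. 0 \<le> t \<Longrightarrow> invertible (flowX M t)"
begin

abbreviation "X \<equiv> flowX M"
abbreviation "S \<equiv> riccati_curve M"
definition "Z t = matrix_inv (X t)"
text \<open>\<open>G\<close> is the controllability gramian \<open>\<integral>\<^sub>0\<^sup>t Z B B\<^sup>T Z\<^sup>T\<close> of the closed loop, since its derivative is
\<open>Z B B\<^sup>T Z\<^sup>T\<close> and \<open>G 0 = 0\<close>. This closed form spares the integral and makes \<open>flow_factor\<close> an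
algebraic identity.\<close>

definition "G t = - (Z t ** blk12 (symplectic_flow A B C t))"

lemma flow_inverse: "0 \<le> t \<Longrightarrow> X t ** Z t = mat 1" "0 \<le> t \<Longrightarrow> Z t ** X t = mat 1"
    "0 \<le> t \<Longrightarrow> V ** X t ** Z t = V" "0 \<le> t \<Longrightarrow> V ** Z t ** X t = V"
  by (simp_all add: Z_def matrix_inv_mult matrix_inv_cancel flow_inv)

lemma Z_0: "Z 0 = mat 1"
  by (auto simp: Z_def flow_0 intro: matrix_inv_eqI)

lemma blk12_flow: "0 \<le> t \<Longrightarrow> blk12 (symplectic_flow A B C t) = - (X t ** G t)"
  by (simp add: G_def mat_simps flow_inverse)

lemma S_sym: "0 \<le> t \<Longrightarrow> transpose (S t) = S t"
  by (intro riccati_curve_sym M_sym flow_inv)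

text \<open>The invariant of \<open>wronskian_constant\<close> for the pair started at \<open>[I; M]\<close> and the one started at \<open>[0; I]\<close>,
multiplied by \<open>Z\<^sup>T\<close>.\<close>

lemma blk22_flow:
  assumes t: "0 \<le> t"
  shows "blk22 (symplectic_flow A B C t) = S t ** blk12 (symplectic_flow A B C t) + transpose (Z t)"
proof -
  let ?U = "blk12 (symplectic_flow A B C t)" and ?V = "blk22 (symplectic_flow A B C t)"
  have "transpose (X t) ** ?V - transpose (flowY M t) ** ?U = mat 1"
    using wronskian_constant[OF hamilton_pair_flow[of M] hamilton_pair_right, of t]
    by (simp add: flow_0 symplectic_flow_0 mat_simps)
  hence "transpose (Z t) ** (transpose (X t) ** ?V - transpose (flowY M t) ** ?U) = transpose (Z t)"
    by simp
  moreover have "transpose (Z t) ** transpose (X t) = mat 1"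
    using flow_inverse[OF t] by (simp flip: matrix_transpose_mul)
  moreover have "transpose (Z t) ** transpose (flowY M t) = S t"
    using S_sym[OF t] by (simp add: riccati_curve_def Z_def matrix_transpose_mul)
  ultimately show ?thesis by (simp add: mat_simps algebra_simps)
qed

text \<open>The dependence of the flow on \<open>P\<close> is reduced to the single factor \<open>I - G (P - M)\<close>: since \<open>X t\<close> is
invertible at all times, the solution from \<open>P\<close> blows up exactly when this factor becomes singular.\<close>

lemma flow_factor:
  assumes t: "0 \<le> t"
  shows "flowX P t = X t ** (mat 1 - G t ** (P - M))"
    and "flowY P t = S t ** flowX P t + transpose (Z t) ** (P - M)"
proof -
  show X: "flowX P t = X t ** (mat 1 - G t ** (P - M))"
    unfolding flow_shift(1)[of P t M] blk12_flow[OF t] by (simp add: mat_simps)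
  have "S t ** X t = flowY M t" by (rule riccati_curve_flow) (rule flow_inv[OF t])
  thus "flowY P t = S t ** flowX P t + transpose (Z t) ** (P - M)"
    unfolding flow_shift[of P t M] blk22_flow[OF t] by (simp add: mat_simps)
qed

lemma has_vector_derivative_Z:
  assumes "0 \<le> t"
  shows "(Z has_vector_derivative Z t ** A + Z t ** K ** S t) (at t within {0..})"
  unfolding Z_def[abs_def] by (rule has_vector_derivative_flow_inv) (use assms flow_inv in auto)

lemma has_vector_derivative_G:
  assumes t: "0 \<le> t"
  shows "(G has_vector_derivative Z t ** K ** transpose (Z t)) (at t within {0..})"
proof -
  have "((\<lambda>t. blk12 (symplectic_flow A B C t)) has_vector_derivative
      - (A ** blk12 (symplectic_flow A B C t)) - K ** blk22 (symplectic_flow A B C t)) (at t within {0..})"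
    using hamilton_pair_right by (auto simp: hamilton_pair_def intro: has_vector_derivative_at_within)
  from has_vector_derivative_minus[OF has_vector_derivative_matmul[OF has_vector_derivative_Z[OF t] this]]
  show ?thesis
    by (simp add: G_def[abs_def] blk22_flow[OF t] mat_simps)
qed

lemma G_0: "G 0 = 0" by (simp add: G_def symplectic_flow_0 mat_simps)

lemma G_sym:
  assumes t: "0 \<le> t"
  shows "transpose (G t) = G t"
proof -
  have "((\<lambda>t. transpose (G t) - G t) has_vector_derivative 0) (at s within {0..})" if "s \<in> {0..}" for s
    using that has_vector_derivative_diff[OF has_vector_derivative_transpose[OF has_vector_derivative_G[of s]] has_vector_derivative_G[of s]]
    by (simp add: mat_simps sym_K)
  from has_vector_derivative_zero_constant[OF convex_real_interval(1) this]
  obtain c where "\<And>s. 0 \<le> s \<Longrightarrow> transpose (G s) - G s = c" by auto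
  from this[of 0] this[of t] t show ?thesis by (simp add: G_0 transpose_arith)
qed

lemma G_form_has_real_derivative:
  assumes "0 < t"
  shows "((\<lambda>s. v \<bullet> (G s *v v)) has_real_derivative
     (transpose B *v (transpose (Z t) *v v)) \<bullet> (transpose B *v (transpose (Z t) *v v))) (at t)"
proof -
  have "(G has_vector_derivative Z t ** K ** transpose (Z t)) (at t)"
    using has_vector_derivative_G[of t] assms at_within_interior[of t "{0..}"] by simp
  hence "((\<lambda>s. v \<bullet> (G s *v v)) has_vector_derivative v \<bullet> ((Z t ** K ** transpose (Z t)) *v v)) (at t)"
    by (intro bounded_linear.has_vector_derivative[OF bounded_linear_inner_right]
          bounded_linear.has_vector_derivative[OF matvec.bounded_linear_left])
  also have "v \<bullet> ((Z t ** K ** transpose (Z t)) *v v) =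
      (transpose B *v (transpose (Z t) *v v)) \<bullet> (transpose B *v (transpose (Z t) *v v))"
    by (simp add: K_def dot_mult_transpose flip: matrix_vector_mul_assoc)
  finally show ?thesis by (simp add: has_real_derivative_iff_has_vector_derivative)
qed

lemma G_continuous: "continuous_on {0..} G"
  using has_vector_derivative_G has_vector_derivative_continuous
  by (metis atLeast_iff continuous_on_eq_continuous_within)

lemma G_mono:
  assumes "0 \<le> s" "s \<le> t"
  shows "v \<bullet> (G s *v v) \<le> v \<bullet> (G t *v v)"
proof (rule DERIV_nonneg_imp_increasing_open[OF assms(2)])
  show "continuous_on {s..t} (\<lambda>r. v \<bullet> (G r *v v))"
    by (intro continuous_on_inner matvec.continuous_on continuous_on_const
          continuous_on_subset[OF G_continuous]) (use assms in auto)
  fix r assume "s < r" "r < t"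
  hence "0 < r" using assms by simp
  from G_form_has_real_derivative[OF this, of v]
  show "\<exists>y. ((\<lambda>r. v \<bullet> (G r *v v)) has_real_derivative y) (at r) \<and> 0 \<le> y"
    using inner_ge_zero by blast
qed

text \<open>If the form of \<open>G t\<close> vanishes at \<open>v\<close>, it vanishes on all of \<open>(0, t)\<close> by monotonicity, hence \<open>B\<^sup>T w = 0\<close>
there for \<open>w = Z\<^sup>T v\<close>. On this interval the closed-loop equation of \<open>w\<close> then reduces to \<open>w' = A\<^sup>T w\<close>, and
repeated differentiation gives \<open>B\<^sup>T (A\<^sup>T)\<^sup>k w = 0\<close> for all \<open>k\<close>, which controllability forbids.\<close>

lemma G_pos_def:
  assumes ctrl: "controllable A B" and t: "0 < t"
  shows "pos_def (G t)"
  unfolding pos_def_def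
proof (intro conjI allI impI)
  show "transpose (G t) = G t" using t by (intro G_sym) auto
  fix v :: "real^'n" assume v: "v \<noteq> 0"
  have nn: "0 \<le> v \<bullet> (G s *v v)" if "0 \<le> s" for s
    using G_mono[of 0 s v] that by (simp add: G_0)
  show "0 < v \<bullet> (G t *v v)"
  proof (rule ccontr)
    assume "\<not> ?thesis"
    hence G: "v \<bullet> (G s *v v) = 0" if "s \<in> {0<..<t}" for s
      using nn[of s] G_mono[of s t v] that by force
    define w where "w s = transpose (Z s) *v v" for s
    have loc: "g' = 0" if "(g has_vector_derivative g') (at s)" "s \<in> {0<..<t}"
      "\<And>r. r \<in> {0<..<t} \<Longrightarrow> g r = 0" for g :: "real \<Rightarrow> 'z::real_normed_vector" and g' s
    proof -
      have "((\<lambda>_. 0) has_vector_derivative g') (at s)"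
        by (rule has_vector_derivative_transform_within_open[OF that(1) _ that(2)])
           (use that(3) in auto)
      thus ?thesis using vector_derivative_unique_at has_vector_derivative_const by blast
    qed
    have Bw: "transpose B *v w s = 0" if s: "s \<in> {0<..<t}" for s
    proof -
      have "((\<lambda>s. v \<bullet> (G s *v v)) has_vector_derivative
          (transpose B *v w s) \<bullet> (transpose B *v w s)) (at s)"
        using G_form_has_real_derivative[of s v] s
        by (simp add: w_def has_real_derivative_iff_has_vector_derivative)
      from loc[OF this s G] show ?thesis by simp
    qed
    have w': "(w has_vector_derivative transpose A *v w s) (at s)" if s: "s \<in> {0<..<t}" for s
    proof -
      have "(Z has_vector_derivative Z s ** A + Z s ** K ** S s) (at s)"
        using has_vector_derivative_Z[of s] s at_within_interior[of s "{0..}"] by simp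
      hence "(w has_vector_derivative transpose (Z s ** A + Z s ** K ** S s) *v v) (at s)"
        unfolding w_def[abs_def]
        by (intro bounded_linear.has_vector_derivative[OF matvec.bounded_linear_left]
              has_vector_derivative_transpose)
      also have "transpose (Z s ** A + Z s ** K ** S s) *v v
          = transpose A *v w s + S s *v (B *v (transpose B *v w s))"
        using s by (simp add: transpose_arith matrix_transpose_mul K_def S_sym w_def
            matvec.add_left flip: matrix_vector_mul_assoc)
      finally show ?thesis using Bw[OF s] by simp
    qed
    have all: "transpose B *v (mat_power (transpose A) k *v w s) = 0" if "s \<in> {0<..<t}" for k s
      using that
    proof (induction k arbitrary: s)
      case (Suc k)
      have "((\<lambda>s. transpose B *v (mat_power (transpose A) k *v w s)) has_vector_derivative
          transpose B *v (mat_power (transpose A) k *v (transpose A *v w s))) (at s)"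
        by (intro bounded_linear.has_vector_derivative[OF matvec.bounded_linear_right] w' Suc.prems)
      from loc[OF this Suc.prems Suc.IH] show ?case
        by (simp add: mat_power_Suc_right matrix_vector_mul_assoc matrix_mul_assoc
            del: funpow.simps)
    qed (simp add: Bw)
    have "w (t/2) = 0"
      by (rule controllable_imp_observable_dual[OF ctrl]) (rule all, use t in auto)
    hence "transpose (X (t/2)) *v w (t/2) = 0" by simp
    moreover have "transpose (X (t/2)) *v w (t/2) = v"
      using flow_inverse(2)[of "t/2"] t by (simp add: w_def matrix_vector_mul_assoc flip: matrix_transpose_mul)
    ultimately show False using v by simp
  qed
qed

text \<open>The solution of the augmented Riccati equation. Its blocks decouple: the first is the reference
solution \<open>S\<close>, the mixed ones solve the linear closed-loop equation, and the last one accumulates the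
gramian.\<close>

definition "Q t = block4 (S t) (- (transpose (Z t) ** M)) (- (M ** Z t)) (M + M ** G t ** M)"

lemma Q_solves_DRE:
  "solves_DRE (block4 A 0 0 (0 :: real^'n^'n)) (vblock B (0 :: real^'m^'n))
     (hblock C (0 :: real^'n^'p)) (block4 M (- M) (- M) M) {0..} Q"
  unfolding solves_DRE_def
proof (intro conjI ballI)
  have "S 0 = M"
    using Z_0 by (simp add: riccati_curve_def flow_0 Z_def)
  thus "Q 0 = block4 M (- M) (- M) M"
    by (simp add: Q_def Z_0 G_0 mat_simps)
  fix t :: real assume t: "t \<in> {0..}"
  hence t0: "0 \<le> t" by simp
  note L = bounded_linear.has_vector_derivative[OF matmul.bounded_linear_left]
    and R = bounded_linear.has_vector_derivative[OF matmul.bounded_linear_right]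
  have D: "(Q has_vector_derivative block4
      (transpose A ** S t + S t ** A + S t ** K ** S t + W)
      (- (transpose (Z t ** A + Z t ** K ** S t) ** M))
      (- (M ** (Z t ** A + Z t ** K ** S t)))
      (0 + M ** (Z t ** K ** transpose (Z t)) ** M)) (at t within {0..})"
    unfolding Q_def[abs_def] using t flow_inv
    by (intro has_vector_derivative_block4 has_vector_derivative_riccati_curve has_vector_derivative_minus
          has_vector_derivative_add has_vector_derivative_const L R
          has_vector_derivative_transpose has_vector_derivative_Z has_vector_derivative_G t0) auto
  have BB: "(q :: real^('n+'n)^('n+'n)) ** vblock B (0 :: real^'m^'n) ** transpose (vblock B (0 :: real^'m^'n)) ** q
      = q ** block4 K 0 0 0 ** q" for q
    by (simp add: vblock_mult_transpose mat_simps K_def flip: matrix_mul_assoc)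
  have CC: "transpose (hblock C (0 :: real^'n^'p)) ** hblock C (0 :: real^'n^'p) = block4 W 0 0 0"
    by (simp add: transpose_hblock_mult mat_simps W_def)
  have "transpose (block4 A 0 0 (0 :: real^'n^'n)) ** Q t + Q t ** block4 A 0 0 (0 :: real^'n^'n)
      + Q t ** block4 K 0 0 0 ** Q t + block4 W 0 0 0 =
    block4
      (transpose A ** S t + S t ** A + S t ** K ** S t + W)
      (- (transpose (Z t ** A + Z t ** K ** S t) ** M))
      (- (M ** (Z t ** A + Z t ** K ** S t)))
      (0 + M ** (Z t ** K ** transpose (Z t)) ** M)"
    by (simp add: Q_def transpose_block4 block4_mult block4_add mat_simps S_sym[OF t0] sym_K)
  with D show "(Q has_vector_derivative
      transpose (block4 A 0 0 (0 :: real^'n^'n)) ** Q t + Q t ** block4 A 0 0 (0 :: real^'n^'n)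
      + Q t ** vblock B (0 :: real^'m^'n) ** transpose (vblock B (0 :: real^'m^'n)) ** Q t
      + transpose (hblock C (0 :: real^'n^'p)) ** hblock C (0 :: real^'n^'p)) (at t within {0..})"
    by (simp only: BB CC)
qed

lemma Q_sym: "0 \<le> t \<Longrightarrow> transpose (Q t) = Q t"
  by (simp add: Q_def transpose_block4 mat_simps S_sym G_sym M_sym)

lemma Q_sol_eq:
  assumes t: "0 \<le> t"
  shows "Q_sol A B C M t = Q t"
proof -
  let ?P = "\<lambda>Q. solves_DRE (block4 A 0 0 (0 :: real^'n^'n)) (vblock B (0 :: real^'m^'n))
     (hblock C (0 :: real^'n^'p)) (block4 M (- M) (- M) M) {0..} Q \<and>
       (\<forall>t\<ge>0. transpose (Q t) = Q t)"
  have "?P (Q_sol A B C M)"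
    unfolding Q_sol_def by (rule someI[of ?P Q]) (simp add: Q_solves_DRE Q_sym)
  thus ?thesis
    using Q_solves_DRE t by (intro solves_DRE_unique[where I = "{0..}" and T = t]) auto
qed

text \<open>All occurrences of \<open>M\<close> in \<open>\<Lambda>\<close> cancel except the shift in the last block, because
\<open>M - Q\<^sup>2\<^sup>2 = - M G M\<close>.\<close>

lemma Lambda_blocks:
  assumes t: "0 \<le> t" and G: "invertible (G t)"
  shows "blk11 (Lambda A B C M t) = S t - transpose (Z t) ** matrix_inv (G t) ** Z t"
    and "blk12 (Lambda A B C M t) = transpose (Z t) ** matrix_inv (G t)"
    and "blk22 (Lambda A B C M t) = - matrix_inv (G t) - M"
proof -
  let ?N = "matrix_inv M" and ?H = "matrix_inv (G t)"
  have "matrix_inv (M - blk22 (Q t)) = - (?N ** ?H ** ?N)"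
    by (rule matrix_inv_eqI(2))
       (simp add: Q_def mat_simps matrix_inv_mult matrix_inv_cancel M_inv G)
  hence L: "Lambda A B C M t = (let W = - (?N ** ?H ** ?N); Q12 = - (transpose (Z t) ** M) in
      block4 (S t + Q12 ** W ** transpose Q12) (Q12 ** W ** M) (M ** W ** transpose Q12) (M ** W ** M - M))"
    by (simp add: Lambda_def Q_sol_eq[OF t] Let_def) (simp add: Q_def)
  show "blk11 (Lambda A B C M t) = S t - transpose (Z t) ** matrix_inv (G t) ** Z t"
    and "blk12 (Lambda A B C M t) = transpose (Z t) ** matrix_inv (G t)"
    and "blk22 (Lambda A B C M t) = - matrix_inv (G t) - M"
    by (simp_all add: L Let_def mat_simps matrix_inv_mult matrix_inv_cancel M_inv M_sym)
qed

text \<open>With \<open>D = P - M\<close>, negative definiteness of \<open>P + \<Lambda>\<^sup>2\<^sup>2 = D - G\<^sup>-\<^sup>1\<close> is equivalent to positive definiteness of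
\<open>D\<^sup>-\<^sup>1 - G\<close> by order reversal, while \<open>flowX P = X (D\<^sup>-\<^sup>1 - G) D\<close>. As \<open>D\<^sup>-\<^sup>1 - G\<close> starts at the positive
definite \<open>D\<^sup>-\<^sup>1\<close> and never increases, being positive definite at \<open>t\<close> is the same as being invertible up to
\<open>t\<close>.\<close>

lemma neg_def_iff_flow_invertible:
  assumes ctrl: "controllable A B" and PM: "pos_def (P - M)" and t: "0 < t"
  shows "neg_def (P + blk22 (Lambda A B C M t)) \<longleftrightarrow> (\<forall>s\<in>{0<..t}. invertible (flowX P s))"
proof -
  define D where "D = P - M"
  let ?E = "matrix_inv D"
  have pD: "pos_def D" using PM by (simp add: D_def)
  note iD = pos_def_invertible[OF pD]
  note Gt = G_pos_def[OF ctrl t]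
  note iG = pos_def_invertible[OF Gt]
  have E: "pos_def ?E" by (rule pos_def_matrix_inv[OF pD])
  have "- (P + blk22 (Lambda A B C M t)) = matrix_inv (G t) - D"
    using Lambda_blocks(3)[of t] iG t by (simp add: D_def)
  hence neg: "neg_def (P + blk22 (Lambda A B C M t)) \<longleftrightarrow> pos_def (matrix_inv (G t) - D)"
    by (simp add: neg_def_def)
  have flow: "flowX P s = X s ** (?E - G s) ** D" if "0 \<le> s" for s
    by (simp add: flow_factor(1)[OF that, of P] D_def[symmetric] mat_simps matrix_inv_mult matrix_inv_cancel iD)
  show ?thesis unfolding neg
  proof
    assume "pos_def (matrix_inv (G t) - D)"
    hence "pos_def (?E - matrix_inv (matrix_inv (G t)))"
      by (rule pos_def_matrix_inv_diff[OF pos_def_matrix_inv[OF Gt] pD])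
    hence EG: "pos_def (?E - G t)"
      unfolding invertible_matrix_inv(2)[OF iG] .
    have pd: "pos_def (?E - G s)" if "s \<in> {0<..t}" for s
    proof -
      have "v \<bullet> ((?E - G t) *v v) \<le> v \<bullet> ((?E - G s) *v v)" for v
        using G_mono[of s t v] that unfolding matvec.diff_left inner_diff_right by simp
      moreover have "transpose (?E - G s) = ?E - G s"
        using E that by (simp add: transpose_arith G_sym pos_def_def)
      ultimately show ?thesis using EG
        unfolding pos_def_def by (blast intro: less_le_trans)
    qed
    show "\<forall>s\<in>{0<..t}. invertible (flowX P s)"
    proof
      fix s assume s: "s \<in> {0<..t}"
      hence "0 \<le> s" by simp
      thus "invertible (flowX P s)"
        unfolding flow[OF \<open>0 \<le> s\<close>]
        by (intro invertible_mult flow_inv pos_def_invertible pd s pD)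
    qed
  next
    assume inv: "\<forall>s\<in>{0<..t}. invertible (flowX P s)"
    have "pos_def (?E - G t)"
    proof (rule pos_def_path[where N = "\<lambda>s. ?E - G s"])
      show "continuous_on {0..t} (\<lambda>s. ?E - G s)"
        by (intro continuous_on_diff continuous_on_const continuous_on_subset[OF G_continuous]) auto
      show "pos_def (?E - G 0)" using E by (simp add: G_0)
      fix s assume s: "s \<in> {0..t}"
      show "transpose (?E - G s) = ?E - G s"
        using E s by (simp add: transpose_arith G_sym pos_def_def)
      have "invertible (flowX P s)"
        using inv s by (cases "s = 0") (auto simp: flow_0 matrix_inv_eqI(1)[of "mat 1" "mat 1"])
      moreover have "?E - G s = Z s ** flowX P s ** ?E"
        using s by (simp add: flow mat_simps flow_inverse matrix_inv_cancel iD)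
      moreover have "invertible (Z s)"
        unfolding Z_def using s by (intro invertible_matrix_inv flow_inv) auto
      ultimately show "invertible (?E - G s)"
        by (auto intro!: invertible_mult pos_def_invertible[OF E])
    qed (use t in auto)
    from pos_def_matrix_inv_diff[OF E Gt this] show "pos_def (matrix_inv (G t) - D)"
      by (simp add: invertible_matrix_inv iD)
  qed
qed

text \<open>The right-hand side is multiplied by \<open>flowX P = - X G R\<close> with \<open>R = P + \<Lambda>\<^sup>2\<^sup>2 = D - G\<^sup>-\<^sup>1\<close>; then every
inverse cancels and \<open>flowY P\<close> of \<open>flow_factor\<close> remains.\<close>

lemma riccati_curve_eq_Lambda:
  assumes t: "0 \<le> t" and G: "invertible (G t)" and inv: "invertible (flowX P t)"
    and R: "invertible (P + blk22 (Lambda A B C M t))"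
  shows "riccati_curve P t = blk11 (Lambda A B C M t) -
     blk12 (Lambda A B C M t) ** matrix_inv (P + blk22 (Lambda A B C M t)) **
       transpose (blk12 (Lambda A B C M t))"
    (is "_ = ?rhs")
proof -
  define D where "D = P - M"
  define H where "H = matrix_inv (G t)"
  define R where "R = P + blk22 (Lambda A B C M t)"
  note L = Lambda_blocks[OF t G, folded H_def]
  have RD: "R = D - H" by (simp add: R_def D_def L)
  have H_sym: "transpose H = H"
    by (simp add: H_def transpose_matrix_inv G G_sym t)
  have GR: "flowX P t = - (X t ** G t ** R)"
    by (simp add: flow_factor(1)[OF t, of P] RD mat_simps H_def D_def matrix_inv_mult matrix_inv_cancel G)
  have HG: "V ** H ** G t = V" for V :: "real^'n^'n" by (simp add: H_def matrix_inv_cancel G)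
  have iR: "V ** matrix_inv R ** R = V" for V :: "real^'n^'n"
    using assms(4) by (simp add: matrix_inv_cancel R_def)
  have "?rhs ** flowX P t = S t ** flowX P t
      - (transpose (Z t) ** H ** Z t) ** flowX P t
      - (transpose (Z t) ** H ** matrix_inv R ** (H ** Z t)) ** flowX P t"
    unfolding R_def[symmetric] L(1,2) by (simp add: mat_simps H_sym)
  also have "\<dots> = S t ** flowX P t + transpose (Z t) ** D"
    unfolding GR by (simp add: mat_simps flow_inverse t HG iR) (simp add: RD mat_simps)
  also have "\<dots> = flowY P t" by (simp add: flow_factor(2)[OF t, of P] D_def)
  finally have "?rhs ** flowX P t ** matrix_inv (flowX P t) = riccati_curve P t"
    by (simp add: riccati_curve_def)
  thus ?thesis by (simp add: matrix_inv_cancel inv)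
qed

end

section \<open>The explicit solution and its horizon\<close>

theorem mainTheorem2:
  fixes A :: "real^'n^'n" and B :: "real^'m^'n" and C :: "real^'n^'p"
    and M P0 :: "real^'n^'n"
  assumes M_sym: "transpose M = M"
    and M_inv: "invertible M"
    and M_horizon: "max_horizon A B C M = \<infinity>"
    and ctrl: "controllable A B"
    and P0_sym: "transpose P0 = P0"
    and P0_M: "pos_def (P0 - M)"
  shows "(\<exists>P. solves_DRE A B C P0 {t. 0 \<le> t \<and> ereal t < max_horizon A B C P0} P \<and>
            (\<forall>t. 0 \<le> t \<and> ereal t < max_horizon A B C P0 \<longrightarrow> transpose (P t) = P t) \<and>
            (\<forall>P'. solves_DRE A B C P0 {t. 0 \<le> t \<and> ereal t < max_horizon A B C P0} P' \<longrightarrow>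
               (\<forall>t. 0 \<le> t \<and> ereal t < max_horizon A B C P0 \<longrightarrow> P' t = P t)) \<and>
            (\<forall>t. 0 < t \<and> ereal t < max_horizon A B C P0 \<longrightarrow>
               invertible (P0 + blk22 (Lambda A B C M t)) \<and>
               P t = blk11 (Lambda A B C M t) -
                     blk12 (Lambda A B C M t) ** matrix_inv (P0 + blk22 (Lambda A B C M t)) **
                       transpose (blk12 (Lambda A B C M t)))) \<and>
         0 < max_horizon A B C P0 \<and>
         max_horizon A B C P0 =
           Sup (ereal ` {t. 0 < t \<and> neg_def (P0 + blk22 (Lambda A B C M t))})"
proof -
  interpret riccati A B C .
  interpret riccati_global A B C M
    by unfold_locales (use M_sym M_inv horizon_less[where P = M] M_horizon in auto)
  let ?I = "{t. 0 \<le> t \<and> ereal t < max_horizon A B C P0}"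
  have inv: "invertible (flowX P0 s)" if "s \<in> ?I" for s
    using horizon_less[of s P0 s] that by simp
  note solves = riccati_curve_solves_DRE[of ?I P0, OF inv]
  have unique: "P' t = riccati_curve P0 t" if "solves_DRE A B C P0 ?I P'" "t \<in> ?I" for P' t
  proof (rule solves_DRE_unique[OF that(1) solves])
    show "{0..t} \<subseteq> ?I"
    proof
      fix s assume s: "s \<in> {0..t}"
      hence "ereal s \<le> ereal t" by simp
      also have "\<dots> < max_horizon A B C P0" using that(2) by simp
      finally show "s \<in> ?I" using s by simp
    qed
  qed (use that(2) in auto)
  have formula: "invertible (P0 + blk22 (Lambda A B C M t)) \<and>
      riccati_curve P0 t = blk11 (Lambda A B C M t) -
        blk12 (Lambda A B C M t) ** matrix_inv (P0 + blk22 (Lambda A B C M t)) **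
          transpose (blk12 (Lambda A B C M t))"
    if t: "0 < t" "ereal t < max_horizon A B C P0" for t
  proof -
    have "\<forall>s\<in>{0<..t}. invertible (flowX P0 s)"
      using horizon_less[OF t(2)] by auto
    hence "neg_def (P0 + blk22 (Lambda A B C M t))"
      using neg_def_iff_flow_invertible[OF ctrl P0_M t(1)] by simp
    hence "invertible (P0 + blk22 (Lambda A B C M t))"
      by (rule neg_def_invertible)
    moreover have "invertible (G t)"
      by (rule pos_def_invertible[OF G_pos_def[OF ctrl t(1)]])
    ultimately show ?thesis
      using riccati_curve_eq_Lambda[of t P0] inv[of t] t by simp
  qed
  have "{t. 0 < t \<and> neg_def (P0 + blk22 (Lambda A B C M t))} =
      {t. 0 < t \<and> (\<forall>s\<in>{0<..t}. invertible (flowX P0 s))}"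
    using neg_def_iff_flow_invertible[OF ctrl P0_M] by blast
  hence sup: "max_horizon A B C P0 =
      Sup (ereal ` {t. 0 < t \<and> neg_def (P0 + blk22 (Lambda A B C M t))})"
    by (simp add: max_horizon_def flowX_def)
  show ?thesis
  proof (intro conjI exI[of _ "riccati_curve P0"] allI impI)
    show "solves_DRE A B C P0 ?I (riccati_curve P0)" by (rule solves)
    show "0 < max_horizon A B C P0" by (rule horizon_pos)
    show "max_horizon A B C P0 =
        Sup (ereal ` {t. 0 < t \<and> neg_def (P0 + blk22 (Lambda A B C M t))})" by (rule sup)
    fix t
    show "transpose (riccati_curve P0 t) = riccati_curve P0 t" if "0 \<le> t \<and> ereal t < max_horizon A B C P0"
      using that by (intro riccati_curve_sym[OF P0_sym] inv) simp
    show "P' t = riccati_curve P0 t" if "solves_DRE A B C P0 ?I P'"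
      "0 \<le> t \<and> ereal t < max_horizon A B C P0" for P'
      by (rule unique[OF that(1)]) (use that(2) in simp)
  qed (use formula in blast)+
qed

end
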